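(* Let $P\colon\mathcal C^{op}\to\mathbf{InfSL}$ be a primary doctrine, and let $(P,(F,a))$ be a $T_e$-algebra. Then $P$ is existential, $F=\mathrm{id}_{\mathcal C}$ and $a=\zeta_P$, where $(\zeta_P)_A\colon P^e(A)\to P(A)$ sends $(f\colon C\to A,\ \alpha)$ to $\exists_f(\alpha)$.
   Context: An inf-semilattice is a poset with finite meets (including a top element $\top$); $\mathbf{InfSL}$ is the category of inf-semilattices and finite-meet-preserving maps. No size distinctions are made between categories and fibres. A primary doctrine is a functor $P\colon \mathcal C^{op}\to\mathbf{InfSL}$ with $\mathcal C$ a category with finite products; for $f\colon A\to B$ write $P_f\colon P(B)\to P(A)$ for its action. A morphism $X\to A$ is called a projection if it is one of the legs of a binary product diagram $A\leftarrow X\to B$ for some object $B$. A primary doctrine $P$ is existential if for every projection $\mathrm{pr}\colon X\to A$ the map $P_{\mathrm{pr}}$ has a left adjoint $\exists_{\mathrm{pr}}$ and these satisfy: (Beck-Chevalley) for any pullback square $f\,\mathrm{pr}'=\mathrm{pr} f'$ with $\mathrm{pr}\colon X\to A$, $\mathrm{pr}'\colon X'\to A'$ projections, $\exists_{\mathrm{pr}'}P_{f'}(\beta)=P_f\exists_{\mathrm{pr}}(\beta)$ for all $\beta\in P(X)$; (Frobenius) $\exists_{\mathrm{pr}}(P_{\mathrm{pr}}(\alpha)\wedge\beta)=\alpha\wedge\exists_{\mathrm{pr}}(\beta)$ for all $\alpha\in P(A)$, $\beta\in P(X)$. The 2-category $\mathbf{PD}$: 0-cells are primary doctrines; 1-cells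 from $P\colon\mathcal C^{op}\to\mathbf{InfSL}$ to $R\colon\mathcal D^{op}\to\mathbf{InfSL}$ are pairs $(F,b)$ with $F\colon\mathcal C\to\mathcal D$ a finite-product-preserving functor and $b\colon P\to R\circ F^{op}$ a natural transformation whose components preserve finite meets; 2-cells $(F,b)\Rightarrow(G,c)$ are natural transformations $\theta\colon F\to G$ with $b_A(\alpha)\le R_{\theta_A}(c_A(\alpha))$ for all $A$, $\alpha\in P(A)$. Existential completion: $P^e(A)$ is the poset reflection of the preorder of pairs $(g\colon B\to A,\ \alpha\in P(B))$ with $g$ a projection, where $(h\colon B\to A,\alpha)\le(f\colon D\to A,\gamma)$ iff there is $w\colon B\to D$ with $fw=h$ and $\alpha\le P_w(\gamma)$; for $f\colon A\to B$, $P^e_f(g\colon C\to B,\beta)=(f^*g,\ P_{g^*f}(\beta))$, with $f^*g\colon D\to A$, $g^*f\colon D\to C$ a pullback of $g$ along $f$. $P^e$ is an existential doctrine, with left adjoints along projections $\exists^e_f(h,\alpha)=(fh,\alpha)$. The 2-monad $(T_e,\mu,\eta)$ on $\mathbf{PD}$: $T_e(P)=P^e$; $T_e(F,b)=(F,b^e)$ with $b^e_A(g\colon C\to A,\alpha)=(Fg\colon FC\to FA,b_C(\alpha))$; $T_e(\theta)=\theta$; $\eta_P=(\mathrm{id}_{\mathcal C},\iota_P)\colon P\to P^e$ with $(\iota_P)_A(\alpha)=(\mathrm{id}_A,\alpha)$; $\mu_P=(\mathrm{id}_{\mathcal C},\zeta_{P^e})\colon (P^e)^e\to P^e$, where $(\zeta_{P^e})_A(f\colon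 C\to A,\overline\alpha)=\exists^e_f(\overline\alpha)$. For a 2-monad $(T,\mu,\eta)$, a $T$-algebra is a pair $(A,a)$ with $a\colon TA\to A$ a 1-cell such that $a\cdot Ta=a\cdot\mu_A$ and $a\cdot\eta_A=1_A$ (strict equalities). *)

theory Defs
  imports "HOL-Algebra.Galois_Connection"
begin

section \<open>Categories and functors\<close>

text \<open>
  Categories are given by carrier sets of objects and morphisms. As usual in HOL-Algebra,
  nothing is required outside the carriers, and equality of functors and of 1-cells below
  means agreement on the carriers.
\<close>

record ('o, 'm) category =
  Obj :: "'o set"
  Mor :: "'m set"
  Dom :: "'m \<Rightarrow> 'o"
  Cod :: "'m \<Rightarrow> 'o"
  Id :: "'o \<Rightarrow> 'm"
  Comp :: "'m \<Rightarrow> 'm \<Rightarrow> 'm"  (infixl \<open>\<cdot>\<index>\<close> 70)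

definition hom :: "('o, 'm, 'z) category_scheme \<Rightarrow> 'o \<Rightarrow> 'o \<Rightarrow> 'm set" where
  "hom C A B = {f \<in> Mor C. Dom C f = A \<and> Cod C f = B}"

locale category =
  fixes C (structure)
  assumes Dom_closed: "f \<in> Mor C \<Longrightarrow> Dom C f \<in> Obj C"
    and Cod_closed: "f \<in> Mor C \<Longrightarrow> Cod C f \<in> Obj C"
    and Id_hom: "A \<in> Obj C \<Longrightarrow> Id C A \<in> hom C A A"
    and Comp_hom: "f \<in> hom C A B \<Longrightarrow> g \<in> hom C B D \<Longrightarrow> g \<cdot> f \<in> hom C A D"
    and Comp_Id: "f \<in> hom C A B \<Longrightarrow> f \<cdot> Id C A = f"
    and Id_Comp: "f \<in> hom C A B \<Longrightarrow> Id C B \<cdot> f = f"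
    and Comp_assoc: "f \<in> hom C A B \<Longrightarrow> g \<in> hom C B D \<Longrightarrow> h \<in> hom C D E \<Longrightarrow>
      h \<cdot> (g \<cdot> f) = (h \<cdot> g) \<cdot> f"

definition terminal :: "('o, 'm, 'z) category_scheme \<Rightarrow> 'o \<Rightarrow> bool" where
  "terminal C T \<longleftrightarrow> T \<in> Obj C \<and> (\<forall>A\<in>Obj C. \<exists>!t. t \<in> hom C A T)"

definition product_diagram :: "('o, 'm, 'z) category_scheme \<Rightarrow> 'm \<Rightarrow> 'm \<Rightarrow> bool" where
  "product_diagram C p q \<longleftrightarrow>
     p \<in> Mor C \<and> q \<in> Mor C \<and> Dom C p = Dom C q \<and>
     (\<forall>Z\<in>Obj C. \<forall>u\<in>hom C Z (Cod C p). \<forall>v\<in>hom C Z (Cod C q).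
        \<exists>!w. w \<in> hom C Z (Dom C p) \<and> p \<cdot>\<^bsub>C\<^esub> w = u \<and> q \<cdot>\<^bsub>C\<^esub> w = v)"

definition projection :: "('o, 'm, 'z) category_scheme \<Rightarrow> 'm \<Rightarrow> bool" where
  "projection C p \<longleftrightarrow> (\<exists>q. product_diagram C p q \<or> product_diagram C q p)"

text \<open>The square is \<open>f \<cdot> g' = g \<cdot> f'\<close>: \<open>g'\<close> is \<open>f\<^sup>*g\<close> and \<open>f'\<close> is \<open>g\<^sup>*f\<close>.\<close>

definition pullback_square ::
    "('o, 'm, 'z) category_scheme \<Rightarrow> 'm \<Rightarrow> 'm \<Rightarrow> 'm \<Rightarrow> 'm \<Rightarrow> bool" where
  "pullback_square C f g g' f' \<longleftrightarrow>
     f \<in> Mor C \<and> g \<in> Mor C \<and> Cod C f = Cod C g \<and>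
     g' \<in> Mor C \<and> f' \<in> Mor C \<and> Dom C g' = Dom C f' \<and>
     Cod C g' = Dom C f \<and> Cod C f' = Dom C g \<and>
     f \<cdot>\<^bsub>C\<^esub> g' = g \<cdot>\<^bsub>C\<^esub> f' \<and>
     (\<forall>Z\<in>Obj C. \<forall>u\<in>hom C Z (Dom C f). \<forall>v\<in>hom C Z (Dom C g).
        f \<cdot>\<^bsub>C\<^esub> u = g \<cdot>\<^bsub>C\<^esub> v \<longrightarrow>
        (\<exists>!w. w \<in> hom C Z (Dom C g') \<and> g' \<cdot>\<^bsub>C\<^esub> w = u \<and> f' \<cdot>\<^bsub>C\<^esub> w = v))"

locale finite_product_category = category +
  assumes terminal_exists: "\<exists>T. terminal C T"
    and products_exist: "A \<in> Obj C \<Longrightarrow> B \<in> Obj C \<Longrightarrow>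
      \<exists>p q. product_diagram C p q \<and> Cod C p = A \<and> Cod C q = B"

record ('o, 'm, 'p, 'n) ftr =
  ob_map :: "'o \<Rightarrow> 'p"
  mor_map :: "'m \<Rightarrow> 'n"

definition is_functor ::
    "('o, 'm) category \<Rightarrow> ('p, 'n) category \<Rightarrow> ('o, 'm, 'p, 'n) ftr \<Rightarrow> bool" where
  "is_functor C D F \<longleftrightarrow>
     (\<forall>A\<in>Obj C. ob_map F A \<in> Obj D) \<and>
     (\<forall>f\<in>Mor C. mor_map F f \<in> hom D (ob_map F (Dom C f)) (ob_map F (Cod C f))) \<and>
     (\<forall>A\<in>Obj C. mor_map F (Id C A) = Id D (ob_map F A)) \<and>
     (\<forall>f\<in>Mor C. \<forall>g\<in>Mor C. Dom C g = Cod C f \<longrightarrow>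
        mor_map F (g \<cdot>\<^bsub>C\<^esub> f) = mor_map F g \<cdot>\<^bsub>D\<^esub> mor_map F f)"

definition preserves_finite_products ::
    "('o, 'm) category \<Rightarrow> ('p, 'n) category \<Rightarrow> ('o, 'm, 'p, 'n) ftr \<Rightarrow> bool" where
  "preserves_finite_products C D F \<longleftrightarrow>
     (\<forall>T. terminal C T \<longrightarrow> terminal D (ob_map F T)) \<and>
     (\<forall>p q. product_diagram C p q \<longrightarrow> product_diagram D (mor_map F p) (mor_map F q))"

definition id_ftr :: "('o, 'm, 'o, 'm) ftr" where
  "id_ftr = \<lparr>ob_map = \<lambda>A. A, mor_map = \<lambda>f. f\<rparr>"

definition comp_ftr ::
    "('p, 'n, 'r, 'l) ftr \<Rightarrow> ('o, 'm, 'p, 'n) ftr \<Rightarrow> ('o, 'm, 'r, 'l) ftr" where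
  "comp_ftr G F = \<lparr>ob_map = ob_map G \<circ> ob_map F, mor_map = mor_map G \<circ> mor_map F\<rparr>"

definition ftr_eq ::
    "('o, 'm) category \<Rightarrow> ('o, 'm, 'p, 'n) ftr \<Rightarrow> ('o, 'm, 'p, 'n) ftr \<Rightarrow> bool" where
  "ftr_eq C F G \<longleftrightarrow>
     (\<forall>A\<in>Obj C. ob_map F A = ob_map G A) \<and> (\<forall>f\<in>Mor C. mor_map F f = mor_map G f)"


section \<open>Primary and existential doctrines\<close>

locale inf_semilattice = lower_semilattice L + weak_partial_order_top L for L (structure)

definition finite_meet_pres :: "'a gorder \<Rightarrow> 'b gorder \<Rightarrow> ('a \<Rightarrow> 'b) \<Rightarrow> bool" where
  "finite_meet_pres L M h \<longleftrightarrow>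
     h \<in> carrier L \<rightarrow> carrier M \<and> h \<top>\<^bsub>L\<^esub> = \<top>\<^bsub>M\<^esub> \<and>
     (\<forall>x\<in>carrier L. \<forall>y\<in>carrier L. h (x \<sqinter>\<^bsub>L\<^esub> y) = h x \<sqinter>\<^bsub>M\<^esub> h y)"

text \<open>\<open>fib P A\<close> is the fibre \<open>P(A)\<close> and \<open>act P f\<close> is \<open>P\<^sub>f : P(Cod f) \<rightarrow> P(Dom f)\<close>.\<close>

record ('o, 'm, 'a) doctrine =
  base :: "('o, 'm) category"
  fib :: "'o \<Rightarrow> 'a gorder"
  act :: "'m \<Rightarrow> 'a \<Rightarrow> 'a"

locale primary_doctrine =
  fixes P :: "('o, 'm, 'a) doctrine"
  assumes base_finite_products: "finite_product_category (base P)"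
    and fib_inf_semilattice: "A \<in> Obj (base P) \<Longrightarrow> inf_semilattice (fib P A)"
    and act_finite_meet_pres: "f \<in> hom (base P) A B \<Longrightarrow>
      finite_meet_pres (fib P B) (fib P A) (act P f)"
    and act_Id: "A \<in> Obj (base P) \<Longrightarrow> \<alpha> \<in> carrier (fib P A) \<Longrightarrow>
      act P (Id (base P) A) \<alpha> = \<alpha>"
    and act_Comp: "f \<in> hom (base P) A B \<Longrightarrow> g \<in> hom (base P) B D \<Longrightarrow>
      \<alpha> \<in> carrier (fib P D) \<Longrightarrow> act P (g \<cdot>\<^bsub>base P\<^esub> f) \<alpha> = act P f (act P g \<alpha>)"

definition left_adjoint_along ::
    "('o, 'm, 'a) doctrine \<Rightarrow> 'm \<Rightarrow> ('a \<Rightarrow> 'a) \<Rightarrow> bool" where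
  "left_adjoint_along P f E \<longleftrightarrow>
     galois_connection \<lparr>orderA = fib P (Dom (base P) f), orderB = fib P (Cod (base P) f),
                        lower = E, upper = act P f\<rparr>"

text \<open>A left adjoint of \<open>act P f\<close> is unique on the carrier, so the choice is immaterial there.\<close>

definition ex_along :: "('o, 'm, 'a) doctrine \<Rightarrow> 'm \<Rightarrow> 'a \<Rightarrow> 'a" where
  "ex_along P f = (SOME E. left_adjoint_along P f E)"

locale existential_doctrine = primary_doctrine +
  assumes left_adjoint_exists: "projection (base P) f \<Longrightarrow> \<exists>E. left_adjoint_along P f E"
    and Beck_Chevalley: "projection (base P) p \<Longrightarrow> projection (base P) p' \<Longrightarrow>
      pullback_square (base P) f p p' f' \<Longrightarrow> \<beta> \<in> carrier (fib P (Dom (base P) p)) \<Longrightarrow>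
      ex_along P p' (act P f' \<beta>) = act P f (ex_along P p \<beta>)"
    and Frobenius: "projection (base P) p \<Longrightarrow> \<alpha> \<in> carrier (fib P (Cod (base P) p)) \<Longrightarrow>
      \<beta> \<in> carrier (fib P (Dom (base P) p)) \<Longrightarrow>
      ex_along P p (act P p \<alpha> \<sqinter>\<^bsub>fib P (Dom (base P) p)\<^esub> \<beta>) =
      \<alpha> \<sqinter>\<^bsub>fib P (Cod (base P) p)\<^esub> ex_along P p \<beta>"


section \<open>1-cells of primary doctrines\<close>

text \<open>The second component \<open>b\<close> of a 1-cell \<open>(F, b)\<close> is indexed by the objects of the source.\<close>

type_synonym ('o, 'm, 'a, 'p, 'n, 'c) cell1 = "('o, 'm, 'p, 'n) ftr \<times> ('o \<Rightarrow> 'a \<Rightarrow> 'c)"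

fun is_cell1 ::
    "('o, 'm, 'a) doctrine \<Rightarrow> ('p, 'n, 'c) doctrine \<Rightarrow> ('o, 'm, 'a, 'p, 'n, 'c) cell1 \<Rightarrow> bool" where
  "is_cell1 P R (F, b) \<longleftrightarrow>
     is_functor (base P) (base R) F \<and>
     preserves_finite_products (base P) (base R) F \<and>
     (\<forall>A\<in>Obj (base P). finite_meet_pres (fib P A) (fib R (ob_map F A)) (b A)) \<and>
     (\<forall>A B. \<forall>f\<in>hom (base P) A B. \<forall>\<beta>\<in>carrier (fib P B).
        b A (act P f \<beta>) = act R (mor_map F f) (b B \<beta>))"

definition id_cell1 :: "('o, 'm, 'a, 'o, 'm, 'a) cell1" where
  "id_cell1 = (id_ftr, \<lambda>A \<alpha>. \<alpha>)"

fun comp_cell1 ::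
    "('p, 'n, 'c, 'r, 'l, 'd) cell1 \<Rightarrow> ('o, 'm, 'a, 'p, 'n, 'c) cell1 \<Rightarrow>
     ('o, 'm, 'a, 'r, 'l, 'd) cell1"  (infixl \<open>\<odot>\<close> 70) where
  "(G, c) \<odot> (F, b) = (comp_ftr G F, \<lambda>A \<alpha>. c (ob_map F A) (b A \<alpha>))"

text \<open>Strict equality of two 1-cells with source \<open>P\<close>.\<close>

fun cell1_eq ::
    "('o, 'm, 'a) doctrine \<Rightarrow> ('o, 'm, 'a, 'p, 'n, 'c) cell1 \<Rightarrow>
     ('o, 'm, 'a, 'p, 'n, 'c) cell1 \<Rightarrow> bool" where
  "cell1_eq P (F, b) (G, c) \<longleftrightarrow>
     ftr_eq (base P) F G \<and>
     (\<forall>A\<in>Obj (base P). \<forall>\<alpha>\<in>carrier (fib P A). b A \<alpha> = c A \<alpha>)"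


section \<open>The existential completion\<close>

text \<open>
  Elements of \<open>P\<^sup>e(A)\<close> are the equivalence classes \<open>ec_class P A (g, \<alpha>)\<close>. Below, \<open>the_elem\<close> of
  the set of all values obtained from representatives (and, for reindexing, from all pullbacks)
  expresses that an operation is defined on classes through representatives.
\<close>

definition ec_pairs :: "('o, 'm, 'a) doctrine \<Rightarrow> 'o \<Rightarrow> ('m \<times> 'a) set" where
  "ec_pairs P A = {(g, \<alpha>). projection (base P) g \<and> Cod (base P) g = A \<and>
                           \<alpha> \<in> carrier (fib P (Dom (base P) g))}"

fun ec_le :: "('o, 'm, 'a) doctrine \<Rightarrow> 'm \<times> 'a \<Rightarrow> 'm \<times> 'a \<Rightarrow> bool" where
  "ec_le P (h, \<alpha>) (f, \<gamma>) \<longleftrightarrow>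
     (\<exists>w\<in>hom (base P) (Dom (base P) h) (Dom (base P) f).
        f \<cdot>\<^bsub>base P\<^esub> w = h \<and> \<alpha> \<sqsubseteq>\<^bsub>fib P (Dom (base P) h)\<^esub> act P w \<gamma>)"

definition ec_class :: "('o, 'm, 'a) doctrine \<Rightarrow> 'o \<Rightarrow> 'm \<times> 'a \<Rightarrow> ('m \<times> 'a) set" where
  "ec_class P A x = {y \<in> ec_pairs P A. ec_le P x y \<and> ec_le P y x}"

definition ec_fib :: "('o, 'm, 'a) doctrine \<Rightarrow> 'o \<Rightarrow> ('m \<times> 'a) set gorder" where
  "ec_fib P A = \<lparr>carrier = ec_class P A ` ec_pairs P A, eq = (=),
                 le = \<lambda>X Y. \<exists>x\<in>X. \<exists>y\<in>Y. ec_le P x y\<rparr>"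

definition ec_act :: "('o, 'm, 'a) doctrine \<Rightarrow> 'm \<Rightarrow> ('m \<times> 'a) set \<Rightarrow> ('m \<times> 'a) set" where
  "ec_act P f X =
     the_elem {ec_class P (Dom (base P) f) (g', act P f' \<beta>) | g \<beta> g' f'.
                 (g, \<beta>) \<in> X \<and> pullback_square (base P) f g g' f'}"

definition ex_completion :: "('o, 'm, 'a) doctrine \<Rightarrow> ('o, 'm, ('m \<times> 'a) set) doctrine" where
  "ex_completion P = \<lparr>base = base P, fib = ec_fib P, act = ec_act P\<rparr>"


section \<open>The 2-monad and its algebras\<close>

text \<open>\<open>Te_cell P R (F, b)\<close> is \<open>(F, b\<^sup>e)\<close> for a 1-cell \<open>(F, b)\<close> from \<open>P\<close> to \<open>R\<close>.\<close>

fun Te_cell ::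
    "('o, 'm, 'a) doctrine \<Rightarrow> ('p, 'n, 'c) doctrine \<Rightarrow> ('o, 'm, 'a, 'p, 'n, 'c) cell1 \<Rightarrow>
     ('o, 'm, ('m \<times> 'a) set, 'p, 'n, ('n \<times> 'c) set) cell1" where
  "Te_cell P R (F, b) =
     (F, \<lambda>A X. the_elem ((\<lambda>(g, \<alpha>). ec_class R (ob_map F A)
                                     (mor_map F g, b (Dom (base P) g) \<alpha>)) ` X))"

definition iota :: "('o, 'm, 'a) doctrine \<Rightarrow> 'o \<Rightarrow> 'a \<Rightarrow> ('m \<times> 'a) set" where
  "iota P A \<alpha> = ec_class P A (Id (base P) A, \<alpha>)"

definition zeta :: "('o, 'm, 'a) doctrine \<Rightarrow> 'o \<Rightarrow> ('m \<times> 'a) set \<Rightarrow> 'a" where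
  "zeta P A X = the_elem ((\<lambda>(f, \<alpha>). ex_along P f \<alpha>) ` X)"

definition eta :: "('o, 'm, 'a) doctrine \<Rightarrow> ('o, 'm, 'a, 'o, 'm, ('m \<times> 'a) set) cell1" where
  "eta P = (id_ftr, iota P)"

definition mu ::
    "('o, 'm, 'a) doctrine \<Rightarrow>
     ('o, 'm, ('m \<times> ('m \<times> 'a) set) set, 'o, 'm, ('m \<times> 'a) set) cell1" where
  "mu P = (id_ftr, zeta (ex_completion P))"

definition Te_algebra ::
    "('o, 'm, 'a) doctrine \<Rightarrow> ('o, 'm, ('m \<times> 'a) set, 'o, 'm, 'a) cell1 \<Rightarrow> bool" where
  "Te_algebra P a \<longleftrightarrow>
     is_cell1 (ex_completion P) P a \<and>
     cell1_eq (ex_completion (ex_completion P)) (a \<odot> Te_cell (ex_completion P) P a) (a \<odot> mu P) \<and>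
     cell1_eq P (a \<odot> eta P) id_cell1"

end

theory Submission
  imports Defs
begin

text \<open>
  Let \<open>(F, a)\<close> be an algebra structure on \<open>P\<close>. The unit \<open>\<eta>\<^sub>P\<close> has the identity as its functor,
  so the unit law \<open>(F, a) \<cdot> \<eta>\<^sub>P = 1\<close> gives \<open>F = id\<close> and \<open>a\<^sub>A(id, \<alpha>) = \<alpha>\<close>. For a projection
  \<open>f : X \<rightarrow> A\<close> put \<open>E\<^sub>f(\<alpha>) = a\<^sub>A(f, \<alpha>)\<close>. In the completion \<open>(f, \<alpha>)\<close> is already the existential
  quantification of \<open>(id, \<alpha>)\<close> along \<open>f\<close>, and each part of the quantifier structure is carried
  over to \<open>P\<close> by one property of \<open>a\<close>:

  \<^item> \<open>E\<^sub>f(P\<^sub>f(\<beta>)) \<le> \<beta>\<close>, because \<open>(f, P\<^sub>f(\<beta>)) \<le> (id, \<beta>)\<close> is witnessed by \<open>f\<close> itself and \<open>a\<^sub>A\<close> is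
    monotone.
  \<^item> \<open>\<alpha> \<le> P\<^sub>f(E\<^sub>f(\<alpha>))\<close>, because naturality rewrites the right-hand side as \<open>a\<^sub>X\<close> of the reindexed
    pair \<open>(f\<^sup>*f, \<dots>)\<close>, and the diagonal \<open>X \<rightarrow> X \<times>\<^sub>A X\<close> witnesses that \<open>(id, \<alpha>)\<close> lies below it.
  \<^item> The Beck-Chevalley condition is naturality of \<open>a\<close>, since reindexing in the completion is
    computed by an arbitrary pullback (\<open>ec_act_class\<close>).
  \<^item> Frobenius reciprocity is preservation of binary meets, since
    \<open>(id, \<alpha>) \<sqinter> (p, \<beta>) = (p, P\<^sub>p(\<alpha>) \<sqinter> \<beta>)\<close> in the completion (\<open>ec_meet_Id\<close>).

  The first two make \<open>E\<^sub>f\<close> a left adjoint of \<open>P\<^sub>f\<close> (\<open>a_left_adjoint\<close>). Left adjoints are unique, so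
  \<open>a\<^sub>A(f, \<alpha>) = \<exists>\<^sub>f(\<alpha>)\<close>, which is the remaining claim \<open>a = \<zeta>\<^sub>P\<close>.
\<close>

section \<open>Meets and meet-preserving maps\<close>

lemma (in partial_order) meet_equality:
  assumes "greatest L i (Lower L {x, y})"
  shows "x \<sqinter> y = i"
  unfolding meet_def inf_def
  by (rule some_equality) (use assms in \<open>auto intro: greatest_unique\<close>)

lemma finite_meet_pres_closed:
  "finite_meet_pres L M h \<Longrightarrow> x \<in> carrier L \<Longrightarrow> h x \<in> carrier M"
  by (auto simp: finite_meet_pres_def)

lemma finite_meet_pres_meet:
  "finite_meet_pres L M h \<Longrightarrow> x \<in> carrier L \<Longrightarrow> y \<in> carrier L \<Longrightarrow>
    h (x \<sqinter>\<^bsub>L\<^esub> y) = h x \<sqinter>\<^bsub>M\<^esub> h y"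
  by (simp add: finite_meet_pres_def)

text \<open>
  Comparable elements of a partial order have a meet, so monotonicity on a fibre of the
  completion follows from preservation of meets before any other meet in that fibre has been
  constructed.
\<close>

lemma finite_meet_pres_mono:
  assumes h: "finite_meet_pres L M h" and L: "partial_order L" and M: "weak_lower_semilattice M"
    and x: "x \<in> carrier L" and y: "y \<in> carrier L" and xy: "x \<sqsubseteq>\<^bsub>L\<^esub> y"
  shows "h x \<sqsubseteq>\<^bsub>M\<^esub> h y"
proof -
  interpret L: partial_order L by (rule L)
  interpret M: weak_lower_semilattice M by (rule M)
  have "x \<sqinter>\<^bsub>L\<^esub> y = x"
    by (rule L.meet_equality) (use x y xy in \<open>auto intro!: greatest_LowerI\<close>)
  with finite_meet_pres_meet[OF h x y] have "h x = h x \<sqinter>\<^bsub>M\<^esub> h y" by simp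
  then show ?thesis
    using M.meet_right finite_meet_pres_closed[OF h] x y by metis
qed

lemma galois_connection_lower_unique:
  assumes E: "galois_connection \<lparr>orderA = L, orderB = M, lower = E, upper = u\<rparr>"
    and E': "galois_connection \<lparr>orderA = L, orderB = M, lower = E', upper = u\<rparr>"
    and x: "x \<in> carrier L"
  shows "E x = E' x"
proof -
  interpret E: galois_connection "\<lparr>orderA = L, orderB = M, lower = E, upper = u\<rparr>" by (rule E)
  interpret E': galois_connection "\<lparr>orderA = L, orderB = M, lower = E', upper = u\<rparr>" by (rule E')
  interpret M: partial_order M using E.is_order_B by simp
  have closed: "E x \<in> carrier M" "E' x \<in> carrier M"
    using E.lower_closed E'.lower_closed x by simp_all
  show ?thesis
    using E.left[of x "E' x"] E'.left[of x "E x"] E.inflation[of x] E'.inflation[of x] closed x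
    by (auto intro: M.le_antisym)
qed

section \<open>Projections and their pullbacks\<close>

lemma product_diagramI:
  assumes p: "p \<in> hom C X A" and q: "q \<in> hom C X B"
    and "\<And>Z u v. Z \<in> Obj C \<Longrightarrow> u \<in> hom C Z A \<Longrightarrow> v \<in> hom C Z B \<Longrightarrow>
      \<exists>!w. w \<in> hom C Z X \<and> p \<cdot>\<^bsub>C\<^esub> w = u \<and> q \<cdot>\<^bsub>C\<^esub> w = v"
  shows "product_diagram C p q"
proof -
  have "p \<in> Mor C" "Dom C p = X" "Cod C p = A" "q \<in> Mor C" "Dom C q = X" "Cod C q = B"
    using p q by (simp_all add: hom_def)
  then show ?thesis unfolding product_diagram_def using assms(3) by simp
qed

lemma product_diagram_hom:
  assumes "product_diagram C p q"
  shows "p \<in> hom C (Dom C p) (Cod C p)" "q \<in> hom C (Dom C p) (Cod C q)"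
  using assms by (simp_all add: product_diagram_def hom_def)

lemma product_diagram_sym:
  assumes pq: "product_diagram C p q"
  shows "product_diagram C q p"
proof (rule product_diagramI)
  fix Z u v
  assume "Z \<in> Obj C" "u \<in> hom C Z (Cod C q)" "v \<in> hom C Z (Cod C p)"
  with pq have "\<exists>!w. w \<in> hom C Z (Dom C p) \<and> p \<cdot>\<^bsub>C\<^esub> w = v \<and> q \<cdot>\<^bsub>C\<^esub> w = u"
    unfolding product_diagram_def by blast
  then show "\<exists>!w. w \<in> hom C Z (Dom C p) \<and> q \<cdot>\<^bsub>C\<^esub> w = u \<and> p \<cdot>\<^bsub>C\<^esub> w = v"
    by (simp add: conj_commute)
qed (use product_diagram_hom[OF pq] in auto)

lemma projection_iff: "projection C p \<longleftrightarrow> (\<exists>q. product_diagram C p q)"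
  unfolding projection_def by (metis product_diagram_sym)

lemma projection_hom: "projection C p \<Longrightarrow> p \<in> hom C (Dom C p) (Cod C p)"
  by (auto simp: projection_iff product_diagram_def hom_def)

lemma product_diagram_pair:
  assumes "product_diagram C p q" "Z \<in> Obj C" "u \<in> hom C Z (Cod C p)" "v \<in> hom C Z (Cod C q)"
  obtains w where "w \<in> hom C Z (Dom C p)" "p \<cdot>\<^bsub>C\<^esub> w = u" "q \<cdot>\<^bsub>C\<^esub> w = v"
  using assms unfolding product_diagram_def by meson

lemma product_diagram_eqI:
  assumes "product_diagram C p q" "Z \<in> Obj C" "w \<in> hom C Z (Dom C p)" "w' \<in> hom C Z (Dom C p)"
    and "p \<cdot>\<^bsub>C\<^esub> w \<in> hom C Z (Cod C p)" "q \<cdot>\<^bsub>C\<^esub> w \<in> hom C Z (Cod C q)"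
    and "p \<cdot>\<^bsub>C\<^esub> w = p \<cdot>\<^bsub>C\<^esub> w'" "q \<cdot>\<^bsub>C\<^esub> w = q \<cdot>\<^bsub>C\<^esub> w'"
  shows "w = w'"
  using assms unfolding product_diagram_def by metis

lemma pullback_squareI:
  assumes f: "f \<in> hom C D A" and g: "g \<in> hom C X A"
    and g': "g' \<in> hom C Y D" and f': "f' \<in> hom C Y X" and eq: "f \<cdot>\<^bsub>C\<^esub> g' = g \<cdot>\<^bsub>C\<^esub> f'"
    and "\<And>Z u v. Z \<in> Obj C \<Longrightarrow> u \<in> hom C Z D \<Longrightarrow> v \<in> hom C Z X \<Longrightarrow> f \<cdot>\<^bsub>C\<^esub> u = g \<cdot>\<^bsub>C\<^esub> v \<Longrightarrow>
      \<exists>!w. w \<in> hom C Z Y \<and> g' \<cdot>\<^bsub>C\<^esub> w = u \<and> f' \<cdot>\<^bsub>C\<^esub> w = v"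
  shows "pullback_square C f g g' f'"
proof -
  have "f \<in> Mor C" "Dom C f = D" "Cod C f = A" "g \<in> Mor C" "Dom C g = X" "Cod C g = A"
    "g' \<in> Mor C" "Dom C g' = Y" "Cod C g' = D" "f' \<in> Mor C" "Dom C f' = Y" "Cod C f' = X"
    using f g g' f' by (simp_all add: hom_def)
  then show ?thesis unfolding pullback_square_def using eq assms(6) by simp
qed

lemma pullback_square_hom:
  assumes "pullback_square C f g g' f'"
  shows "f \<in> hom C (Dom C f) (Cod C f)" "g \<in> hom C (Dom C g) (Cod C f)"
    "g' \<in> hom C (Dom C g') (Dom C f)" "f' \<in> hom C (Dom C g') (Dom C g)"
    "f \<cdot>\<^bsub>C\<^esub> g' = g \<cdot>\<^bsub>C\<^esub> f'"
  using assms by (auto simp: pullback_square_def hom_def)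

lemma pullback_square_pair:
  assumes "pullback_square C f g g' f'" "Z \<in> Obj C"
    and "u \<in> hom C Z (Dom C f)" "v \<in> hom C Z (Dom C g)" "f \<cdot>\<^bsub>C\<^esub> u = g \<cdot>\<^bsub>C\<^esub> v"
  obtains w where "w \<in> hom C Z (Dom C g')" "g' \<cdot>\<^bsub>C\<^esub> w = u" "f' \<cdot>\<^bsub>C\<^esub> w = v"
  using assms unfolding pullback_square_def by meson

lemma pullback_square_eqI:
  assumes "pullback_square C f g g' f'" "Z \<in> Obj C"
    and "w \<in> hom C Z (Dom C g')" "w' \<in> hom C Z (Dom C g')"
    and "g' \<cdot>\<^bsub>C\<^esub> w \<in> hom C Z (Dom C f)" "f' \<cdot>\<^bsub>C\<^esub> w \<in> hom C Z (Dom C g)"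
    and "f \<cdot>\<^bsub>C\<^esub> (g' \<cdot>\<^bsub>C\<^esub> w) = g \<cdot>\<^bsub>C\<^esub> (f' \<cdot>\<^bsub>C\<^esub> w)"
    and "g' \<cdot>\<^bsub>C\<^esub> w = g' \<cdot>\<^bsub>C\<^esub> w'" "f' \<cdot>\<^bsub>C\<^esub> w = f' \<cdot>\<^bsub>C\<^esub> w'"
  shows "w = w'"
  using assms unfolding pullback_square_def by metis

context category
begin

lemma hom_Obj: "f \<in> hom C A B \<Longrightarrow> A \<in> Obj C \<and> B \<in> Obj C"
  using Dom_closed Cod_closed by (auto simp: hom_def)

text \<open>Along \<open>f : D \<rightarrow> A\<close>, the projection \<open>A \<times> B \<rightarrow> A\<close> pulls back to \<open>D \<times> B \<rightarrow> D\<close>.\<close>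

lemma product_diagram_pullback:
  assumes pq: "product_diagram C p q" and sq: "pullback_square C f p p' f'"
  shows "product_diagram C p' (q \<cdot> f')"
proof -
  note h = pullback_square_hom[OF sq]
  have q: "q \<in> hom C (Dom C p) (Cod C q)" using product_diagram_hom[OF pq] by simp
  have cod: "Cod C f = Cod C p" using h(2) by (simp add: hom_def)
  have qf: "q \<cdot> f' \<in> hom C (Dom C p') (Cod C q)"
    using Comp_hom[OF h(4) q] .
  show ?thesis
  proof (rule product_diagramI[OF h(3) qf])
    fix Z u v
    assume Z: "Z \<in> Obj C" and u: "u \<in> hom C Z (Dom C f)" and v: "v \<in> hom C Z (Cod C q)"
    have fu: "f \<cdot> u \<in> hom C Z (Cod C p)" using Comp_hom[OF u h(1)] cod by simp
    obtain t where t: "t \<in> hom C Z (Dom C p)" "p \<cdot> t = f \<cdot> u" "q \<cdot> t = v"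
      using product_diagram_pair[OF pq Z fu v] by metis
    obtain w where w: "w \<in> hom C Z (Dom C p')" "p' \<cdot> w = u" "f' \<cdot> w = t"
      using pullback_square_pair[OF sq Z u t(1)] t(2) by metis
    show "\<exists>!w. w \<in> hom C Z (Dom C p') \<and> p' \<cdot> w = u \<and> (q \<cdot> f') \<cdot> w = v"
    proof (rule ex1I[of _ w])
      show "w \<in> hom C Z (Dom C p') \<and> p' \<cdot> w = u \<and> (q \<cdot> f') \<cdot> w = v"
        using w t(3) Comp_assoc[OF w(1) h(4) q] by simp
    next
      fix w' assume w': "w' \<in> hom C Z (Dom C p') \<and> p' \<cdot> w' = u \<and> (q \<cdot> f') \<cdot> w' = v"
      then have w'h: "w' \<in> hom C Z (Dom C p')" by simp
      have f'w': "f' \<cdot> w' \<in> hom C Z (Dom C p)" using Comp_hom[OF w'h h(4)] .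
      have "p \<cdot> (f' \<cdot> w') = f \<cdot> u"
        using Comp_assoc[OF w'h h(4) h(2)] Comp_assoc[OF w'h h(3) h(1)] h(5) w' by simp
      moreover have "q \<cdot> (f' \<cdot> w') = v"
        using Comp_assoc[OF w'h h(4) q] w' by simp
      ultimately have "f' \<cdot> w' = t"
        using product_diagram_eqI[OF pq Z f'w' t(1)] fu v t by simp
      then show "w' = w"
        using pullback_square_eqI[OF sq Z w'h w(1)] w w' u t by simp
    qed
  qed
qed

lemma projection_pullback:
  "projection C p \<Longrightarrow> pullback_square C f p p' f' \<Longrightarrow> projection C p'"
  unfolding projection_iff using product_diagram_pullback by blast

end

context finite_product_category
begin

text \<open>
  The identity of \<open>A\<close> is the first leg of \<open>A \<times> 1\<close>.
\<close>

lemma projection_Id: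
  assumes A: "A \<in> Obj C"
  shows "projection C (Id C A)"
proof -
  obtain T where T: "terminal C T" using terminal_exists ..
  then obtain t where t: "t \<in> hom C A T" using A by (auto simp: terminal_def)
  have I: "Id C A \<in> hom C A A" using Id_hom[OF A] .
  have "product_diagram C (Id C A) t"
  proof (rule product_diagramI[OF I t])
    fix Z u v
    assume Z: "Z \<in> Obj C" and u: "u \<in> hom C Z A" and v: "v \<in> hom C Z T"
    have "t \<cdot> u = v" using T Comp_hom[OF u t] v Z by (auto simp: terminal_def)
    then show "\<exists>!w. w \<in> hom C Z A \<and> Id C A \<cdot> w = u \<and> t \<cdot> w = v"
      using u Id_Comp by metis
  qed
  then show ?thesis by (auto simp: projection_iff)
qed

text \<open>
  If \<open>p\<close> is the leg \<open>A \<times> B \<rightarrow> A\<close> and \<open>f : D \<rightarrow> A\<close>, the first leg of \<open>D \<times> B\<close> and the map \<open>f \<times> B\<close>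
  complete a pullback square.
\<close>

lemma pullback_of_projection_exists:
  assumes p: "projection C p" and f: "f \<in> hom C D (Cod C p)"
  obtains p' f' where "pullback_square C f p p' f'"
proof -
  obtain q where pq: "product_diagram C p q" using p by (auto simp: projection_iff)
  have q: "q \<in> hom C (Dom C p) (Cod C q)" and ph: "p \<in> hom C (Dom C p) (Cod C p)"
    using product_diagram_hom[OF pq] by simp_all
  have D: "D \<in> Obj C" and Q: "Cod C q \<in> Obj C" using hom_Obj f q by blast+
  obtain r s where rs: "product_diagram C r s" and cod: "Cod C r = D" "Cod C s = Cod C q"
    using products_exist[OF D Q] by metis
  have r: "r \<in> hom C (Dom C r) D" and s: "s \<in> hom C (Dom C r) (Cod C q)"
    using product_diagram_hom[OF rs] cod by simp_all
  have R: "Dom C r \<in> Obj C" using hom_Obj r by blast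
  have fr: "f \<cdot> r \<in> hom C (Dom C r) (Cod C p)" using Comp_hom[OF r f] .
  obtain f' where f': "f' \<in> hom C (Dom C r) (Dom C p)" "p \<cdot> f' = f \<cdot> r" "q \<cdot> f' = s"
    using product_diagram_pair[OF pq R fr s] by metis
  have "pullback_square C f p r f'"
  proof (rule pullback_squareI[OF f ph r f'(1) f'(2)[symmetric]])
    fix Z u v
    assume Z: "Z \<in> Obj C" and u: "u \<in> hom C Z D" and v: "v \<in> hom C Z (Dom C p)"
      and fu: "f \<cdot> u = p \<cdot> v"
    have qv: "q \<cdot> v \<in> hom C Z (Cod C q)" using Comp_hom[OF v q] .
    obtain w where w: "w \<in> hom C Z (Dom C r)" "r \<cdot> w = u" "s \<cdot> w = q \<cdot> v"
      using product_diagram_pair[OF rs Z] u qv cod by metis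
    have "p \<cdot> (f' \<cdot> w) = p \<cdot> v"
      using Comp_assoc[OF w(1) f'(1) ph] Comp_assoc[OF w(1) r f] f' w fu by simp
    moreover have "q \<cdot> (f' \<cdot> w) = q \<cdot> v"
      using Comp_assoc[OF w(1) f'(1) q] f' w by simp
    ultimately have f'w: "f' \<cdot> w = v"
      using product_diagram_eqI[OF pq Z Comp_hom[OF w(1) f'(1)] v] Comp_hom[OF v ph] qv by simp
    show "\<exists>!w. w \<in> hom C Z (Dom C r) \<and> r \<cdot> w = u \<and> f' \<cdot> w = v"
    proof (rule ex1I[of _ w])
      show "w \<in> hom C Z (Dom C r) \<and> r \<cdot> w = u \<and> f' \<cdot> w = v" using w f'w by simp
    next
      fix w' assume w': "w' \<in> hom C Z (Dom C r) \<and> r \<cdot> w' = u \<and> f' \<cdot> w' = v"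
      then have w'h: "w' \<in> hom C Z (Dom C r)" by simp
      have "s \<cdot> w' = q \<cdot> v"
        using Comp_assoc[OF w'h f'(1) q] f' w' by simp
      then show "w' = w"
        using product_diagram_eqI[OF rs Z w'h w(1)] w w' u qv cod by simp
    qed
  qed
  then show thesis by (rule that)
qed

end

section \<open>The order and the reindexing of the existential completion\<close>

sublocale primary_doctrine \<subseteq> finite_product_category "base P"
  by (rule base_finite_products)

lemma mem_ec_pairs:
  "(g, \<alpha>) \<in> ec_pairs P A \<longleftrightarrow>
    projection (base P) g \<and> Cod (base P) g = A \<and> \<alpha> \<in> carrier (fib P (Dom (base P) g))"
  by (simp add: ec_pairs_def)

lemma ec_pairs_hom: "(g, \<alpha>) \<in> ec_pairs P A \<Longrightarrow> g \<in> hom (base P) (Dom (base P) g) A"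
  using projection_hom by (auto simp: mem_ec_pairs)

lemma ec_leI:
  assumes "w \<in> hom (base P) (Dom (base P) h) (Dom (base P) f)" "f \<cdot>\<^bsub>base P\<^esub> w = h"
    and "\<alpha> \<sqsubseteq>\<^bsub>fib P (Dom (base P) h)\<^esub> act P w \<gamma>"
  shows "ec_le P (h, \<alpha>) (f, \<gamma>)"
  using assms by auto

context primary_doctrine
begin

lemma fib_partial_order: "A \<in> Obj (base P) \<Longrightarrow> partial_order (fib P A)"
  using fib_inf_semilattice by (simp add: inf_semilattice_def lower_semilattice_def)

lemma fib_lower_semilattice: "A \<in> Obj (base P) \<Longrightarrow> weak_lower_semilattice (fib P A)"
  using fib_inf_semilattice
  by (metis inf_semilattice_def lower_semilattice.axioms(1) lower_semilattice.inf_of_two_exists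
      partial_order.axioms(1) weak_lower_semilattice.intro weak_lower_semilattice_axioms.intro)

lemma act_closed:
  "f \<in> hom (base P) A B \<Longrightarrow> \<beta> \<in> carrier (fib P B) \<Longrightarrow> act P f \<beta> \<in> carrier (fib P A)"
  using act_finite_meet_pres finite_meet_pres_closed by metis

lemma act_mono:
  assumes "f \<in> hom (base P) A B" "\<beta> \<in> carrier (fib P B)" "\<gamma> \<in> carrier (fib P B)"
    and "\<beta> \<sqsubseteq>\<^bsub>fib P B\<^esub> \<gamma>"
  shows "act P f \<beta> \<sqsubseteq>\<^bsub>fib P A\<^esub> act P f \<gamma>"
  using finite_meet_pres_mono[OF act_finite_meet_pres] fib_partial_order fib_lower_semilattice
    hom_Obj assms by metis

lemma fib_refl: "A \<in> Obj (base P) \<Longrightarrow> \<alpha> \<in> carrier (fib P A) \<Longrightarrow> \<alpha> \<sqsubseteq>\<^bsub>fib P A\<^esub> \<alpha>"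
  using fib_lower_semilattice by (metis weak_lower_semilattice.axioms(1) weak_partial_order.le_refl)

lemma fib_trans:
  assumes "A \<in> Obj (base P)" "\<alpha> \<sqsubseteq>\<^bsub>fib P A\<^esub> \<beta>" "\<beta> \<sqsubseteq>\<^bsub>fib P A\<^esub> \<gamma>"
    and "\<alpha> \<in> carrier (fib P A)" "\<beta> \<in> carrier (fib P A)" "\<gamma> \<in> carrier (fib P A)"
  shows "\<alpha> \<sqsubseteq>\<^bsub>fib P A\<^esub> \<gamma>"
  using fib_lower_semilattice assms
  by (meson weak_lower_semilattice.axioms(1) weak_partial_order.le_trans)

lemma ec_le_refl:
  assumes x: "x \<in> ec_pairs P A"
  shows "ec_le P x x"
proof -
  obtain g \<alpha> where x_eq: "x = (g, \<alpha>)" by (cases x)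
  have g: "g \<in> hom (base P) (Dom (base P) g) A" and \<alpha>: "\<alpha> \<in> carrier (fib P (Dom (base P) g))"
    using x ec_pairs_hom[of g \<alpha> P A] by (auto simp: x_eq mem_ec_pairs)
  then have "Dom (base P) g \<in> Obj (base P)" using hom_Obj by blast
  then show ?thesis
    unfolding x_eq using Id_hom Comp_Id[OF g] act_Id \<alpha> fib_refl by (intro ec_leI) auto
qed

lemma ec_le_trans:
  assumes xy: "ec_le P x y" and yz: "ec_le P y z"
    and x: "x \<in> ec_pairs P A" and y: "y \<in> ec_pairs P A" and z: "z \<in> ec_pairs P A"
  shows "ec_le P x z"
proof -
  obtain f \<alpha> g \<beta> h \<gamma> where eqs: "x = (f, \<alpha>)" "y = (g, \<beta>)" "z = (h, \<gamma>)"
    by (cases x, cases y, cases z)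
  let ?X = "Dom (base P) f" and ?Y = "Dom (base P) g" and ?Z = "Dom (base P) h"
  obtain v where v: "v \<in> hom (base P) ?X ?Y" "g \<cdot>\<^bsub>base P\<^esub> v = f" "\<alpha> \<sqsubseteq>\<^bsub>fib P ?X\<^esub> act P v \<beta>"
    using xy by (auto simp: eqs)
  obtain w where w: "w \<in> hom (base P) ?Y ?Z" "h \<cdot>\<^bsub>base P\<^esub> w = g" "\<beta> \<sqsubseteq>\<^bsub>fib P ?Y\<^esub> act P w \<gamma>"
    using yz by (auto simp: eqs)
  have h: "h \<in> hom (base P) ?Z A" using z ec_pairs_hom by (auto simp: eqs)
  have cs: "\<alpha> \<in> carrier (fib P ?X)" "\<beta> \<in> carrier (fib P ?Y)" "\<gamma> \<in> carrier (fib P ?Z)"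
    using x y z by (auto simp: eqs mem_ec_pairs)
  have wv: "w \<cdot>\<^bsub>base P\<^esub> v \<in> hom (base P) ?X ?Z" using Comp_hom[OF v(1) w(1)] .
  have w\<gamma>: "act P w \<gamma> \<in> carrier (fib P ?Y)" using act_closed[OF w(1) cs(3)] .
  have "act P v \<beta> \<sqsubseteq>\<^bsub>fib P ?X\<^esub> act P v (act P w \<gamma>)"
    using act_mono[OF v(1) cs(2) w\<gamma> w(3)] .
  then have "\<alpha> \<sqsubseteq>\<^bsub>fib P ?X\<^esub> act P v (act P w \<gamma>)"
    using fib_trans v cs act_closed[OF v(1)] w\<gamma> hom_Obj by meson
  then have "\<alpha> \<sqsubseteq>\<^bsub>fib P ?X\<^esub> act P (w \<cdot>\<^bsub>base P\<^esub> v) \<gamma>"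
    using act_Comp[OF v(1) w(1) cs(3)] by simp
  moreover have "h \<cdot>\<^bsub>base P\<^esub> (w \<cdot>\<^bsub>base P\<^esub> v) = f"
    using Comp_assoc[OF v(1) w(1) h] v w by simp
  ultimately show ?thesis unfolding eqs using wv by (intro ec_leI) auto
qed

lemma ec_class_eqI:
  assumes "x \<in> ec_pairs P A" "y \<in> ec_pairs P A" "ec_le P x y" "ec_le P y x"
  shows "ec_class P A x = ec_class P A y"
  using assms ec_le_trans unfolding ec_class_def by blast

lemma ec_class_self: "x \<in> ec_pairs P A \<Longrightarrow> x \<in> ec_class P A x"
  using ec_le_refl by (simp add: ec_class_def)

lemma ec_class_memD:
  assumes "x \<in> ec_pairs P A" "y \<in> ec_class P A x"
  shows "y \<in> ec_pairs P A" "ec_le P x y" "ec_le P y x" "ec_class P A y = ec_class P A x"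
proof -
  show "y \<in> ec_pairs P A" "ec_le P x y" "ec_le P y x"
    using assms(2) by (simp_all add: ec_class_def)
  then show "ec_class P A y = ec_class P A x"
    using assms(1) by (intro ec_class_eqI)
qed

lemma ec_class_closed: "x \<in> ec_pairs P A \<Longrightarrow> ec_class P A x \<in> carrier (ec_fib P A)"
  by (simp add: ec_fib_def)

lemma ec_fib_le_iff:
  assumes "x \<in> ec_pairs P A" "y \<in> ec_pairs P A"
  shows "ec_class P A x \<sqsubseteq>\<^bsub>ec_fib P A\<^esub> ec_class P A y \<longleftrightarrow> ec_le P x y"
proof
  assume "ec_class P A x \<sqsubseteq>\<^bsub>ec_fib P A\<^esub> ec_class P A y"
  then obtain x' y' where x': "x' \<in> ec_class P A x" and y': "y' \<in> ec_class P A y"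
      and le: "ec_le P x' y'"
    by (auto simp: ec_fib_def)
  note x = ec_class_memD[OF assms(1) x'] and y = ec_class_memD[OF assms(2) y']
  have "ec_le P x y'" using ec_le_trans[OF x(2) le assms(1) x(1) y(1)] .
  then show "ec_le P x y" using ec_le_trans[OF _ y(3) assms(1) y(1) assms(2)] by simp
next
  assume "ec_le P x y"
  then show "ec_class P A x \<sqsubseteq>\<^bsub>ec_fib P A\<^esub> ec_class P A y"
    using ec_class_self[OF assms(1)] ec_class_self[OF assms(2)]
    by (simp add: ec_fib_def) blast
qed

lemma ec_fib_cases:
  assumes "X \<in> carrier (ec_fib P A)"
  obtains x where "x \<in> ec_pairs P A" "X = ec_class P A x"
  using assms by (auto simp: ec_fib_def)

lemma ec_fib_partial_order: "partial_order (ec_fib P A)"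
proof
  show "(.=\<^bsub>ec_fib P A\<^esub>) = (=)" by (simp add: ec_fib_def)
next
  fix X assume "X \<in> carrier (ec_fib P A)"
  then obtain x where x: "x \<in> ec_pairs P A" "X = ec_class P A x" by (rule ec_fib_cases)
  then show "X \<sqsubseteq>\<^bsub>ec_fib P A\<^esub> X" using ec_fib_le_iff ec_le_refl by simp
next
  fix X Y assume XY: "X \<sqsubseteq>\<^bsub>ec_fib P A\<^esub> Y" "Y \<sqsubseteq>\<^bsub>ec_fib P A\<^esub> X"
    and "X \<in> carrier (ec_fib P A)" "Y \<in> carrier (ec_fib P A)"
  then obtain x y where x: "x \<in> ec_pairs P A" "X = ec_class P A x"
      and y: "y \<in> ec_pairs P A" "Y = ec_class P A y"
    by (meson ec_fib_cases)
  have "X = Y"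
    unfolding x(2) y(2) using XY x y ec_fib_le_iff by (intro ec_class_eqI) simp_all
  then show "X .=\<^bsub>ec_fib P A\<^esub> Y" by (simp add: ec_fib_def)
next
  fix X Y Z assume XYZ: "X \<sqsubseteq>\<^bsub>ec_fib P A\<^esub> Y" "Y \<sqsubseteq>\<^bsub>ec_fib P A\<^esub> Z"
    and "X \<in> carrier (ec_fib P A)" "Y \<in> carrier (ec_fib P A)" "Z \<in> carrier (ec_fib P A)"
  then obtain x y z where x: "x \<in> ec_pairs P A" "X = ec_class P A x"
      and y: "y \<in> ec_pairs P A" "Y = ec_class P A y"
      and z: "z \<in> ec_pairs P A" "Z = ec_class P A z"
    by (meson ec_fib_cases)
  have "ec_le P x y" "ec_le P y z" using XYZ x y z ec_fib_le_iff by simp_all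
  then have "ec_le P x z" using ec_le_trans x y z by blast
  then show "X \<sqsubseteq>\<^bsub>ec_fib P A\<^esub> Z" using x z ec_fib_le_iff by simp
qed (auto simp: ec_fib_def)

lemma ec_pairs_pullback:
  assumes "(g, \<beta>) \<in> ec_pairs P B" "pullback_square (base P) f g g' f'"
  shows "(g', act P f' \<beta>) \<in> ec_pairs P (Dom (base P) f)"
  using assms projection_pullback[OF _ assms(2)] pullback_square_hom(3)[OF assms(2)]
    act_closed[OF pullback_square_hom(4)[OF assms(2)]]
  by (simp add: mem_ec_pairs hom_def)

text \<open>
  A witness \<open>w\<close> of \<open>(h, \<gamma>) \<le> (g, \<beta>)\<close> induces a map between the two pullbacks, which witnesses the
  inequality of the reindexed pairs. Applied in both directions this makes reindexing
  independent of the representative and of the pullback chosen.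
\<close>

lemma ec_le_pullback:
  assumes le: "ec_le P (h, \<gamma>) (g, \<beta>)"
    and h\<gamma>: "(h, \<gamma>) \<in> ec_pairs P B" and g\<beta>: "(g, \<beta>) \<in> ec_pairs P B"
    and sqh: "pullback_square (base P) f h h' k" and sqg: "pullback_square (base P) f g g' f'"
  shows "ec_le P (h', act P k \<gamma>) (g', act P f' \<beta>)"
proof -
  let ?H = "Dom (base P) h" and ?G = "Dom (base P) g"
  let ?H' = "Dom (base P) h'" and ?G' = "Dom (base P) g'"
  note hh = pullback_square_hom[OF sqh] and gg = pullback_square_hom[OF sqg]
  obtain w where w: "w \<in> hom (base P) ?H ?G" "g \<cdot>\<^bsub>base P\<^esub> w = h" "\<gamma> \<sqsubseteq>\<^bsub>fib P ?H\<^esub> act P w \<beta>"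
    using le by auto
  have cs: "\<gamma> \<in> carrier (fib P ?H)" "\<beta> \<in> carrier (fib P ?G)"
    using h\<gamma> g\<beta> by (auto simp: mem_ec_pairs)
  have H': "?H' \<in> Obj (base P)" using hom_Obj hh(3) by blast
  have wk: "w \<cdot>\<^bsub>base P\<^esub> k \<in> hom (base P) ?H' ?G" using Comp_hom[OF hh(4) w(1)] .
  have "f \<cdot>\<^bsub>base P\<^esub> h' = g \<cdot>\<^bsub>base P\<^esub> (w \<cdot>\<^bsub>base P\<^esub> k)"
    using Comp_assoc[OF hh(4) w(1) gg(2)] w hh(5) by simp
  then obtain u where u: "u \<in> hom (base P) ?H' ?G'" "g' \<cdot>\<^bsub>base P\<^esub> u = h'"
      "f' \<cdot>\<^bsub>base P\<^esub> u = w \<cdot>\<^bsub>base P\<^esub> k"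
    using pullback_square_pair[OF sqg H' hh(3) wk] by metis
  have "act P k \<gamma> \<sqsubseteq>\<^bsub>fib P ?H'\<^esub> act P k (act P w \<beta>)"
    using act_mono[OF hh(4) cs(1) act_closed[OF w(1) cs(2)] w(3)] .
  also have "act P k (act P w \<beta>) = act P u (act P f' \<beta>)"
    using act_Comp[OF hh(4) w(1) cs(2)] act_Comp[OF u(1) gg(4) cs(2)] u(3) by simp
  finally show ?thesis using u by (intro ec_leI) auto
qed

lemma ec_act_class:
  assumes g\<beta>: "(g, \<beta>) \<in> ec_pairs P B" and sq: "pullback_square (base P) f g g' f'"
  shows "ec_act P f (ec_class P B (g, \<beta>)) = ec_class P (Dom (base P) f) (g', act P f' \<beta>)"
proof -
  have "ec_class P (Dom (base P) f) (h', act P k \<gamma>) = ec_class P (Dom (base P) f) (g', act P f' \<beta>)"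
    if "(h, \<gamma>) \<in> ec_class P B (g, \<beta>)" and sqh: "pullback_square (base P) f h h' k" for h \<gamma> h' k
    using ec_class_memD[OF g\<beta> that(1)] g\<beta> sq sqh
    by (intro ec_class_eqI ec_pairs_pullback ec_le_pullback)
  then have "{ec_class P (Dom (base P) f) (h', act P k \<gamma>) | h \<gamma> h' k.
        (h, \<gamma>) \<in> ec_class P B (g, \<beta>) \<and> pullback_square (base P) f h h' k} =
      {ec_class P (Dom (base P) f) (g', act P f' \<beta>)}"
    using ec_class_self[OF g\<beta>] sq by blast
  then show ?thesis unfolding ec_act_def by simp
qed

lemma ec_pairs_Id: "A \<in> Obj (base P) \<Longrightarrow> \<alpha> \<in> carrier (fib P A) \<Longrightarrow> (Id (base P) A, \<alpha>) \<in> ec_pairs P A"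
  using projection_Id Id_hom by (auto simp: mem_ec_pairs hom_def)

text \<open>
  The only candidate for a witness of an inequality over an identity is the projection itself.
\<close>

lemma ec_le_Id_iff:
  assumes g\<beta>: "(g, \<beta>) \<in> ec_pairs P A" and \<alpha>: "\<alpha> \<in> carrier (fib P A)"
  shows "ec_le P (g, \<beta>) (Id (base P) A, \<alpha>) \<longleftrightarrow> \<beta> \<sqsubseteq>\<^bsub>fib P (Dom (base P) g)\<^esub> act P g \<alpha>"
proof -
  have g: "g \<in> hom (base P) (Dom (base P) g) A" using ec_pairs_hom[OF g\<beta>] .
  have "Dom (base P) (Id (base P) A) = A" using Id_hom hom_Obj g by (auto simp: hom_def)
  then show ?thesis using Id_Comp g by auto
qed

text \<open>
  The meet of two arbitrary pairs involves a pullback of the projections; if one of them is an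
  identity, that pullback is trivial.
\<close>

lemma ec_meet_Id:
  assumes g\<beta>: "(g, \<beta>) \<in> ec_pairs P A" and \<alpha>: "\<alpha> \<in> carrier (fib P A)"
  shows "ec_class P A (Id (base P) A, \<alpha>) \<sqinter>\<^bsub>ec_fib P A\<^esub> ec_class P A (g, \<beta>) =
    ec_class P A (g, act P g \<alpha> \<sqinter>\<^bsub>fib P (Dom (base P) g)\<^esub> \<beta>)"
proof -
  let ?G = "Dom (base P) g"
  let ?m = "act P g \<alpha> \<sqinter>\<^bsub>fib P ?G\<^esub> \<beta>"
  have g: "g \<in> hom (base P) ?G A" using ec_pairs_hom[OF g\<beta>] .
  have A: "A \<in> Obj (base P)" and G: "?G \<in> Obj (base P)" using hom_Obj g by blast+
  interpret G: weak_lower_semilattice "fib P ?G" using fib_lower_semilattice[OF G] .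
  have \<beta>: "\<beta> \<in> carrier (fib P ?G)" using g\<beta> by (simp add: mem_ec_pairs)
  have g\<alpha>: "act P g \<alpha> \<in> carrier (fib P ?G)" using act_closed[OF g \<alpha>] .
  have gm: "(g, ?m) \<in> ec_pairs P A" using g\<beta> g\<alpha> \<beta> by (simp add: mem_ec_pairs)
  note I = ec_pairs_Id[OF A \<alpha>]
  have le1: "ec_le P (g, ?m) (Id (base P) A, \<alpha>)"
    using ec_le_Id_iff[OF gm \<alpha>] G.meet_left[OF g\<alpha> \<beta>] by simp
  have le2: "ec_le P (g, ?m) (g, \<beta>)"
    using Id_hom[OF G] Comp_Id[OF g] act_Id[OF G \<beta>] G.meet_right[OF g\<alpha> \<beta>] by (intro ec_leI) auto
  have glb: "ec_le P (h, \<gamma>) (g, ?m)"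
    if h\<gamma>: "(h, \<gamma>) \<in> ec_pairs P A" and le_I: "ec_le P (h, \<gamma>) (Id (base P) A, \<alpha>)"
      and le_g: "ec_le P (h, \<gamma>) (g, \<beta>)" for h \<gamma>
  proof -
    let ?H = "Dom (base P) h"
    obtain w where w: "w \<in> hom (base P) ?H ?G" "g \<cdot>\<^bsub>base P\<^esub> w = h" "\<gamma> \<sqsubseteq>\<^bsub>fib P ?H\<^esub> act P w \<beta>"
      using le_g by auto
    have H: "?H \<in> Obj (base P)" using hom_Obj w(1) by blast
    interpret H: weak_lower_semilattice "fib P ?H" using fib_lower_semilattice[OF H] .
    have "\<gamma> \<sqsubseteq>\<^bsub>fib P ?H\<^esub> act P h \<alpha>" using ec_le_Id_iff[OF h\<gamma> \<alpha>] le_I by simp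
    also have "act P h \<alpha> = act P w (act P g \<alpha>)" using act_Comp[OF w(1) g \<alpha>] w(2) by simp
    finally have "\<gamma> \<sqsubseteq>\<^bsub>fib P ?H\<^esub> act P w (act P g \<alpha>) \<sqinter>\<^bsub>fib P ?H\<^esub> act P w \<beta>"
      using w(3) h\<gamma> act_closed[OF w(1)] g\<alpha> \<beta> by (intro H.meet_le) (auto simp: mem_ec_pairs)
    then have "\<gamma> \<sqsubseteq>\<^bsub>fib P ?H\<^esub> act P w ?m"
      using finite_meet_pres_meet[OF act_finite_meet_pres[OF w(1)] g\<alpha> \<beta>] by simp
    then show ?thesis using w by (intro ec_leI)
  qed
  interpret E: partial_order "ec_fib P A" by (rule ec_fib_partial_order)
  show ?thesis
  proof (rule E.meet_equality, rule greatest_LowerI)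
    fix X assume "X \<in> {ec_class P A (Id (base P) A, \<alpha>), ec_class P A (g, \<beta>)}"
    then show "ec_class P A (g, ?m) \<sqsubseteq>\<^bsub>ec_fib P A\<^esub> X"
      using le1 le2 ec_fib_le_iff[OF gm I] ec_fib_le_iff[OF gm g\<beta>] by auto
  next
    fix Y assume Y: "Y \<in> Lower (ec_fib P A) {ec_class P A (Id (base P) A, \<alpha>), ec_class P A (g, \<beta>)}"
    then have "Y \<in> carrier (ec_fib P A)" by (simp add: Lower_def)
    then obtain h \<gamma> where h\<gamma>: "(h, \<gamma>) \<in> ec_pairs P A" and Y_eq: "Y = ec_class P A (h, \<gamma>)"
      by (elim ec_fib_cases) auto
    have "ec_class P A (h, \<gamma>) \<sqsubseteq>\<^bsub>ec_fib P A\<^esub> ec_class P A (Id (base P) A, \<alpha>)"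
      "ec_class P A (h, \<gamma>) \<sqsubseteq>\<^bsub>ec_fib P A\<^esub> ec_class P A (g, \<beta>)"
      using Y ec_class_closed[OF I] ec_class_closed[OF g\<beta>] by (auto simp: Lower_def Y_eq)
    then show "Y \<sqsubseteq>\<^bsub>ec_fib P A\<^esub> ec_class P A (g, ?m)"
      unfolding Y_eq using glb[OF h\<gamma>] h\<gamma> gm I g\<beta> by (simp add: ec_fib_le_iff)
  qed (use ec_class_closed I g\<beta> gm in auto)
qed

end

section \<open>Retractions of the unit of the completion\<close>

text \<open>
  This is the fibrewise part of a 1-cell from the completion to \<open>P\<close> over the identity functor.
\<close>

locale unit_retraction = primary_doctrine P for P :: "('o, 'm, 'a) doctrine" +
  fixes a :: "'o \<Rightarrow> ('m \<times> 'a) set \<Rightarrow> 'a"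
  assumes a_meet_pres: "A \<in> Obj (base P) \<Longrightarrow> finite_meet_pres (ec_fib P A) (fib P A) (a A)"
    and a_natural: "f \<in> hom (base P) A B \<Longrightarrow> X \<in> carrier (ec_fib P B) \<Longrightarrow>
      a A (ec_act P f X) = act P f (a B X)"
    and a_unit: "A \<in> Obj (base P) \<Longrightarrow> \<alpha> \<in> carrier (fib P A) \<Longrightarrow> a A (iota P A \<alpha>) = \<alpha>"
begin

lemma a_mono:
  assumes "x \<in> ec_pairs P A" "y \<in> ec_pairs P A" "ec_le P x y" "A \<in> Obj (base P)"
  shows "a A (ec_class P A x) \<sqsubseteq>\<^bsub>fib P A\<^esub> a A (ec_class P A y)"
  using assms(3) ec_fib_le_iff[OF assms(1,2)]
  by (intro finite_meet_pres_mono[OF a_meet_pres ec_fib_partial_order fib_lower_semilattice]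
      ec_class_closed assms(1,2,4)) simp

text \<open>
  The inequality \<open>\<alpha> \<le> P\<^sub>f(E\<^sub>f(\<alpha>))\<close> is where naturality enters: it turns a comparison in the
  completion, given by a diagonal, into one in \<open>P\<close>. The other half of the adjunction only compares
  pairs in a single fibre of the completion.
\<close>

lemma a_left_adjoint:
  assumes f: "projection (base P) f"
  shows "left_adjoint_along P f (\<lambda>\<alpha>. a (Cod (base P) f) (ec_class P (Cod (base P) f) (f, \<alpha>)))"
proof -
  let ?A = "Cod (base P) f" and ?X = "Dom (base P) f"
  let ?E = "\<lambda>\<alpha>. a ?A (ec_class P ?A (f, \<alpha>))"
  have fh: "f \<in> hom (base P) ?X ?A" using projection_hom[OF f] .
  have A: "?A \<in> Obj (base P)" and X: "?X \<in> Obj (base P)" using hom_Obj fh by blast+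
  have pair: "(f, \<alpha>) \<in> ec_pairs P ?A" if "\<alpha> \<in> carrier (fib P ?X)" for \<alpha>
    using f that by (simp add: mem_ec_pairs)
  have E_closed: "?E \<alpha> \<in> carrier (fib P ?A)" if "\<alpha> \<in> carrier (fib P ?X)" for \<alpha>
    using finite_meet_pres_closed[OF a_meet_pres[OF A]] ec_class_closed pair that by blast
  have inflation: "\<alpha> \<sqsubseteq>\<^bsub>fib P ?X\<^esub> act P f (?E \<alpha>)" if \<alpha>: "\<alpha> \<in> carrier (fib P ?X)" for \<alpha>
  proof -
    obtain p q where sq: "pullback_square (base P) f f p q"
      using pullback_of_projection_exists[OF f fh] .
    note h = pullback_square_hom[OF sq]
    have I: "Id (base P) ?X \<in> hom (base P) ?X ?X" using Id_hom[OF X] .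
    \<comment> \<open>The diagonal of the kernel pair of \<open>f\<close> compares \<open>(id, \<alpha>)\<close> with the reindexing of \<open>(f, \<alpha>)\<close>.\<close>
    obtain d where d: "d \<in> hom (base P) ?X (Dom (base P) p)"
        "p \<cdot>\<^bsub>base P\<^esub> d = Id (base P) ?X" "q \<cdot>\<^bsub>base P\<^esub> d = Id (base P) ?X"
      using pullback_square_pair[OF sq X I I] by metis
    have "act P d (act P q \<alpha>) = \<alpha>"
      using act_Comp[OF d(1) h(4) \<alpha>] d(3) act_Id[OF X \<alpha>] by simp
    then have "ec_le P (Id (base P) ?X, \<alpha>) (p, act P q \<alpha>)"
      using d I fib_refl[OF X \<alpha>] by (intro ec_leI) (auto simp: hom_def)
    then have "a ?X (iota P ?X \<alpha>) \<sqsubseteq>\<^bsub>fib P ?X\<^esub> a ?X (ec_class P ?X (p, act P q \<alpha>))"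
      unfolding iota_def
      using ec_pairs_Id[OF X \<alpha>] ec_pairs_pullback[OF pair[OF \<alpha>] sq] X by (intro a_mono)
    also have "a ?X (ec_class P ?X (p, act P q \<alpha>)) = act P f (?E \<alpha>)"
      using ec_act_class[OF pair[OF \<alpha>] sq] a_natural[OF fh ec_class_closed[OF pair[OF \<alpha>]]] by simp
    finally show ?thesis using a_unit[OF X \<alpha>] by simp
  qed
  have E_le: "?E \<alpha> \<sqsubseteq>\<^bsub>fib P ?A\<^esub> \<beta>"
    if \<alpha>: "\<alpha> \<in> carrier (fib P ?X)" and \<beta>: "\<beta> \<in> carrier (fib P ?A)"
      and le: "\<alpha> \<sqsubseteq>\<^bsub>fib P ?X\<^esub> act P f \<beta>" for \<alpha> \<beta>
  proof -
    have "?E \<alpha> \<sqsubseteq>\<^bsub>fib P ?A\<^esub> a ?A (iota P ?A \<beta>)"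
      unfolding iota_def using pair[OF \<alpha>] ec_pairs_Id[OF A \<beta>] ec_le_Id_iff[OF pair[OF \<alpha>] \<beta>] le A
      by (intro a_mono) auto
    then show ?thesis using a_unit[OF A \<beta>] by simp
  qed
  have le_act: "\<alpha> \<sqsubseteq>\<^bsub>fib P ?X\<^esub> act P f \<beta>"
    if \<alpha>: "\<alpha> \<in> carrier (fib P ?X)" and \<beta>: "\<beta> \<in> carrier (fib P ?A)" and le: "?E \<alpha> \<sqsubseteq>\<^bsub>fib P ?A\<^esub> \<beta>"
    for \<alpha> \<beta>
    using fib_trans[OF X inflation[OF \<alpha>] act_mono[OF fh E_closed[OF \<alpha>] \<beta> le] \<alpha>]
      act_closed[OF fh] E_closed[OF \<alpha>] \<beta> by blast
  show ?thesis
    unfolding left_adjoint_along_def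
    using fib_partial_order[OF A] fib_partial_order[OF X] act_closed[OF fh] E_closed E_le le_act
    by (intro galois_connection.intro connection.intro galois_connection_axioms.intro) auto
qed

lemma ex_along_eq:
  assumes f\<alpha>: "(f, \<alpha>) \<in> ec_pairs P A"
  shows "ex_along P f \<alpha> = a A (ec_class P A (f, \<alpha>))"
proof -
  have f: "projection (base P) f" "Cod (base P) f = A" "\<alpha> \<in> carrier (fib P (Dom (base P) f))"
    using f\<alpha> by (auto simp: mem_ec_pairs)
  note adj = a_left_adjoint[OF f(1)]
  have "left_adjoint_along P f (ex_along P f)"
    unfolding ex_along_def by (rule someI[of "left_adjoint_along P f", OF adj])
  then show ?thesis
    using galois_connection_lower_unique[OF _ _ f(3)] adj f(2) unfolding left_adjoint_along_def
    by simp
qed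

text \<open>
  By \<open>ex_along_eq\<close>, the value \<open>\<exists>\<^sub>f(\<alpha>)\<close> depends on the pair \<open>(f, \<alpha>)\<close> only through its class, so the
  set whose unique element defines \<open>zeta\<close> is a singleton.
\<close>

lemma zeta_class:
  assumes f\<alpha>: "(f, \<alpha>) \<in> ec_pairs P A"
  shows "zeta P A (ec_class P A (f, \<alpha>)) = ex_along P f \<alpha>"
proof -
  have "ex_along P g \<beta> = ex_along P f \<alpha>" if "(g, \<beta>) \<in> ec_class P A (f, \<alpha>)" for g \<beta>
    using ec_class_memD[OF f\<alpha> that] by (simp add: ex_along_eq[of g \<beta> A] ex_along_eq[OF f\<alpha>])
  then have "(\<lambda>(g, \<beta>). ex_along P g \<beta>) ` ec_class P A (f, \<alpha>) =
      (\<lambda>_. ex_along P f \<alpha>) ` ec_class P A (f, \<alpha>)"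
    by (intro image_cong) auto
  also have "\<dots> = {ex_along P f \<alpha>}"
    using ec_class_self[OF f\<alpha>] by (intro image_constant)
  finally have "(\<lambda>(g, \<beta>). ex_along P g \<beta>) ` ec_class P A (f, \<alpha>) = {ex_along P f \<alpha>}" .
  then show ?thesis by (simp add: zeta_def)
qed

lemma a_eq_zeta: "X \<in> carrier (ec_fib P A) \<Longrightarrow> a A X = zeta P A X"
  by (elim ec_fib_cases) (auto simp: zeta_class ex_along_eq)

lemma existential: "existential_doctrine P"
proof
  fix f assume "projection (base P) f"
  then show "\<exists>E. left_adjoint_along P f E" using a_left_adjoint by blast
next
  fix p p' f f' \<beta>
  assume p: "projection (base P) p" and sq: "pullback_square (base P) f p p' f'"
    and \<beta>: "\<beta> \<in> carrier (fib P (Dom (base P) p))"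
  have f: "f \<in> hom (base P) (Dom (base P) f) (Cod (base P) p)"
    using sq by (simp add: pullback_square_def hom_def)
  have p\<beta>: "(p, \<beta>) \<in> ec_pairs P (Cod (base P) p)" using p \<beta> by (simp add: mem_ec_pairs)
  show "ex_along P p' (act P f' \<beta>) = act P f (ex_along P p \<beta>)"
    using a_natural[OF f ec_class_closed[OF p\<beta>]] ec_act_class[OF p\<beta> sq]
      ex_along_eq[OF ec_pairs_pullback[OF p\<beta> sq]] ex_along_eq[OF p\<beta>] by simp
next
  fix p \<alpha> \<beta>
  assume p: "projection (base P) p" and \<alpha>: "\<alpha> \<in> carrier (fib P (Cod (base P) p))"
    and \<beta>: "\<beta> \<in> carrier (fib P (Dom (base P) p))"
  let ?A = "Cod (base P) p" and ?X = "Dom (base P) p"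
  have ph: "p \<in> hom (base P) ?X ?A" using projection_hom[OF p] .
  have A: "?A \<in> Obj (base P)" and X: "?X \<in> Obj (base P)" using hom_Obj ph by blast+
  have p\<beta>: "(p, \<beta>) \<in> ec_pairs P ?A" using p \<beta> by (simp add: mem_ec_pairs)
  have pm: "(p, act P p \<alpha> \<sqinter>\<^bsub>fib P ?X\<^esub> \<beta>) \<in> ec_pairs P ?A"
    using p \<beta> act_closed[OF ph \<alpha>] weak_lower_semilattice.meet_closed[OF fib_lower_semilattice[OF X]]
    by (simp add: mem_ec_pairs)
  have "ex_along P p (act P p \<alpha> \<sqinter>\<^bsub>fib P ?X\<^esub> \<beta>) =
      a ?A (iota P ?A \<alpha> \<sqinter>\<^bsub>ec_fib P ?A\<^esub> ec_class P ?A (p, \<beta>))"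
    using ex_along_eq[OF pm] ec_meet_Id[OF p\<beta> \<alpha>] by (simp add: iota_def)
  also have "\<dots> = a ?A (iota P ?A \<alpha>) \<sqinter>\<^bsub>fib P ?A\<^esub> a ?A (ec_class P ?A (p, \<beta>))"
    using ec_class_closed ec_pairs_Id[OF A \<alpha>] p\<beta>
    by (intro finite_meet_pres_meet[OF a_meet_pres[OF A]]) (auto simp: iota_def)
  also have "\<dots> = \<alpha> \<sqinter>\<^bsub>fib P ?A\<^esub> ex_along P p \<beta>"
    using a_unit[OF A \<alpha>] ex_along_eq[OF p\<beta>] by simp
  finally show "ex_along P p (act P p \<alpha> \<sqinter>\<^bsub>fib P ?X\<^esub> \<beta>) = \<alpha> \<sqinter>\<^bsub>fib P ?A\<^esub> ex_along P p \<beta>" .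
qed

end

section \<open>Algebras of the existential completion\<close>

text \<open>
  The functor of \<open>(F, a) \<odot> eta P\<close> is \<open>F\<close> itself, and the unit law equates it with the identity.
\<close>

lemma Te_algebra_functor:
  assumes "Te_algebra P (F, a)"
  shows "ftr_eq (base P) F id_ftr"
  using assms by (auto simp: Te_algebra_def eta_def id_cell1_def comp_ftr_def id_ftr_def ftr_eq_def)

lemma Te_algebra_unit_retraction:
  assumes P: "primary_doctrine P" and alg: "Te_algebra P (F, a)"
  shows "unit_retraction P a"
proof -
  have F: "ob_map F A = A" if "A \<in> Obj (base P)" for A
    using Te_algebra_functor[OF alg] that by (simp add: ftr_eq_def id_ftr_def)
  have Fm: "mor_map F f = f" if "f \<in> hom (base P) A B" for f A B
    using Te_algebra_functor[OF alg] that by (simp add: ftr_eq_def id_ftr_def hom_def)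
  have cell: "is_cell1 (ex_completion P) P (F, a)"
    and unit: "cell1_eq P ((F, a) \<odot> eta P) id_cell1"
    using alg by (simp_all add: Te_algebra_def)
  show ?thesis
    using P cell unit F Fm
    by (auto simp: unit_retraction_def unit_retraction_axioms_def ex_completion_def eta_def
        id_cell1_def id_ftr_def)
qed

theorem proposition5p3:
  fixes P :: "('o, 'm, 'a) doctrine"
    and F :: "('o, 'm, 'o, 'm) ftr"
    and a :: "'o \<Rightarrow> ('m \<times> 'a) set \<Rightarrow> 'a"
  assumes "primary_doctrine P"
    and "Te_algebra P (F, a)"
  shows "existential_doctrine P \<and>
         ftr_eq (base P) F id_ftr \<and>
         (\<forall>A\<in>Obj (base P). \<forall>X\<in>carrier (fib (ex_completion P) A). a A X = zeta P A X) \<and>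
         (\<forall>A\<in>Obj (base P). \<forall>f \<alpha>. (f, \<alpha>) \<in> ec_pairs P A \<longrightarrow>
            zeta P A (ec_class P A (f, \<alpha>)) = ex_along P f \<alpha>)"
proof -
  interpret unit_retraction P a using Te_algebra_unit_retraction[OF assms] .
  show ?thesis
    using existential Te_algebra_functor[OF assms(2)] a_eq_zeta zeta_class
    by (simp add: ex_completion_def)
qed

end
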